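(* Let $H\in\mathbb{C}^{n\times n}$ be an invertible Hermitian matrix and let $B\in\mathbb{C}^{n\times n}$ be $H$-nonnegative, with positive eigenvalues $\lambda_1,\ldots,\lambda_q>0$ and negative eigenvalues $\lambda_{q+1},\ldots,\lambda_r<0$, counting multiplicities. Then for any square root $A$ of $B$ there exist signs $\delta_1,\ldots,\delta_r\in\{1,-1\}$ and a Segre pairing $\mathcal{S}$ of $B$ such that the Jordan form of $A$ is (up to the order of the blocks) $A_-\oplus A_0\oplus A_+$, where $$A_+=\bigoplus_{j=1}^{q}J_1\bigl(\delta_j\sqrt{\lambda_j}\bigr),\qquad A_-=\bigoplus_{j=1}^{r-q}J_1\bigl(i\,\delta_{q+j}\sqrt{-\lambda_{q+j}}\bigr),$$ $$A_0=\bigoplus_{i=1}^{\ell_1}J_1(0)\oplus\bigoplus_{i=1}^{\ell_2}J_2(0)\oplus\bigoplus_{i=1}^{\ell_3}J_3(0)\oplus\bigoplus_{i=1}^{\ell_4}J_4(0),$$ and $\ell_1,\ell_2,\ell_3,\ell_4$ denote the numbers of pairs $(1,0)$, $(1,1)$, $(2,1)$, $(2,2)$ in $\mathcal{S}$, respectively.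
   Context: With $(\cdot,\cdot)$ the Euclidean inner product on $\mathbb{C}^n$ and $[x,y]=(Hx,y)$, a matrix $B\in\mathbb{C}^{n\times n}$ is $H$-nonnegative if $[Bx,x]\ge 0$ for all $x\in\mathbb{C}^n$. (Such a $B$ has real spectrum, its nonzero eigenvalues are semisimple, and its Jordan blocks at $0$ have size at most two.) A square root of $B$ is a matrix $A\in\mathbb{C}^{n\times n}$ with $A^2=B$. $J_k(\lambda)$ denotes the $k\times k$ Jordan block with eigenvalue $\lambda$. Let $(n_1,\ldots,n_p)$ be the Segre characteristic of $B$ at $0$, i.e. the list of sizes of the Jordan blocks of $B$ at eigenvalue $0$ in decreasing order (empty if $B$ is invertible). A Segre pairing of $B$ is a finite collection (with repetitions allowed, arranged lexicographically) of pairs of numbers from $\{n_1,\ldots,n_p\}\cup\{0\}$ such that: each entry $n_i$ (counted with multiplicity) appears in one and only one pair; each pair consists either of two entries of the Segre characteristic or of one entry of the Segre characteristic and one zero, with first entry greater than or equal to the second; and the absolute difference between the two entries of each pair is at most one. *)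

theory Defs
  imports
    "Jordan_Normal_Form.Jordan_Normal_Form_Existence"
    "Jordan_Normal_Form.Jordan_Normal_Form_Uniqueness"
    "HOL-Library.Multiset"
    "HOL-Library.Nonpos_Ints"
begin

definition indef_inner :: "complex mat \<Rightarrow> complex vec \<Rightarrow> complex vec \<Rightarrow> complex" where
  "indef_inner H x y = (H *\<^sub>v x) \<bullet>c y"

text \<open>Membership in \<open>\<real>\<^sub>\<ge>\<^sub>0\<close> says that the complex number \<open>[Bx,x]\<close> is real and nonnegative.\<close>

definition H_nonnegative :: "nat \<Rightarrow> complex mat \<Rightarrow> complex mat \<Rightarrow> bool" where
  "H_nonnegative n H B \<longleftrightarrow>
     B \<in> carrier_mat n n \<and> (\<forall>x \<in> carrier_vec n. indef_inner H (B *\<^sub>v x) x \<in> \<real>\<^sub>\<ge>\<^sub>0)"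

definition square_root_of :: "nat \<Rightarrow> complex mat \<Rightarrow> complex mat \<Rightarrow> bool" where
  "square_root_of n B A \<longleftrightarrow> A \<in> carrier_mat n n \<and> A ^\<^sub>m 2 = B"

definition zero_block_sizes :: "(nat \<times> complex) list \<Rightarrow> nat list" where
  "zero_block_sizes n_as = rev (sort (map fst (filter (\<lambda>na. snd na = 0) n_as)))"

definition segre_char :: "complex mat \<Rightarrow> nat list" where
  "segre_char B = (THE ns. \<exists>n_as. jordan_nf B n_as \<and> ns = zero_block_sizes n_as)"

lemma zero_block_sizes_unique:
  assumes a: "jordan_nf B n_as" and b: "jordan_nf B m_as"
  shows "zero_block_sizes n_as = zero_block_sizes m_as"
proof -
  let ?f = "\<lambda>xs :: (nat \<times> complex) list. map fst (filter (\<lambda>na. snd na = 0) xs)"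
  have cnt: "count (mset (?f xs)) k = length (filter ((=) (k, 0)) xs)" for k xs
  proof (induct xs)
    case (Cons a xs)
    then show ?case by (cases a) auto
  qed simp
  have eq: "count (mset (?f n_as)) k = count (mset (?f m_as)) k" for k
  proof (cases "k = 0")
    case True
    have "k \<notin> set (?f n_as)" "k \<notin> set (?f m_as)"
      using a b True unfolding jordan_nf_def by force+
    then show ?thesis
      by (metis count_eq_zero_iff set_mset_mset)
  next
    case False
    show ?thesis
      unfolding cnt using compute_nr_of_jordan_blocks[OF a False, of 0]
        compute_nr_of_jordan_blocks[OF b False, of 0]
      by simp
  qed
  have "mset (?f n_as) = mset (?f m_as)"
    by (rule multiset_eqI) (rule eq)
  then have "sort (?f n_as) = sort (?f m_as)"
    by (metis mset_sort properties_for_sort sorted_sort)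
  then show ?thesis
    unfolding zero_block_sizes_def by simp
qed

lemma segre_char_eq:
  assumes "jordan_nf B n_as"
  shows "segre_char B = zero_block_sizes n_as"
  unfolding segre_char_def
  by (rule the_equality) (use assms zero_block_sizes_unique in blast)+

text \<open>
  A finite collection with repetitions is a multiset, which is also why the lexicographic
  arrangement of the pairs needs no encoding. The last conjunct says that every entry of the Segre
  characteristic, counted with multiplicity, is used exactly once; the entries are all positive
  (\<open>jordan_nf\<close> excludes blocks of size zero), so the zeros that it filters out are precisely
  the padding entries.
\<close>

definition segre_pairing :: "complex mat \<Rightarrow> (nat \<times> nat) multiset \<Rightarrow> bool" where
  "segre_pairing B S \<longleftrightarrow>
     (\<forall>(a, b) \<in># S. a \<in> set (segre_char B) \<and> b \<in> set (segre_char B) \<union> {0} \<and>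
        a \<ge> b \<and> \<bar>int a - int b\<bar> \<le> 1) \<and>
     filter_mset (\<lambda>k. k \<noteq> 0) (image_mset fst S + image_mset snd S) = mset (segre_char B)"

text \<open>
  \<open>ev 1, \<dots>, ev q\<close> are the positive and \<open>ev (q+1), \<dots>, ev r\<close> the negative eigenvalues of
  \<open>B\<close>, each listed according to its algebraic multiplicity.
\<close>

definition signed_eigenvalues :: "complex mat \<Rightarrow> nat \<Rightarrow> nat \<Rightarrow> (nat \<Rightarrow> real) \<Rightarrow> bool" where
  "signed_eigenvalues B q r ev \<longleftrightarrow>
     q \<le> r \<and> (\<forall>j \<in> {1..q}. ev j > 0) \<and> (\<forall>j \<in> {q+1..r}. ev j < 0) \<and>
     (\<forall>x :: real. x \<noteq> 0 \<longrightarrow>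
        card {j \<in> {1..r}. ev j = x} = Polynomial.order (complex_of_real x) (char_poly B))"

text \<open>
  Block lists in the format of \<open>jordan_nf\<close>: an entry \<open>(k, \<mu>)\<close> stands for \<open>J\<^sub>k(\<mu>)\<close>, and
  appending lists is the direct sum.
\<close>

definition A_plus :: "nat \<Rightarrow> (nat \<Rightarrow> real) \<Rightarrow> (nat \<Rightarrow> real) \<Rightarrow> (nat \<times> complex) list" where
  "A_plus q ev \<delta> = map (\<lambda>j. (1, complex_of_real (\<delta> j * sqrt (ev j)))) [1..<q+1]"

definition A_minus ::
    "nat \<Rightarrow> nat \<Rightarrow> (nat \<Rightarrow> real) \<Rightarrow> (nat \<Rightarrow> real) \<Rightarrow> (nat \<times> complex) list" where
  "A_minus q r ev \<delta> =
     map (\<lambda>j. (1, \<i> * complex_of_real (\<delta> (q + j) * sqrt (- ev (q + j))))) [1..<(r-q)+1]"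

definition A_zero :: "(nat \<times> nat) multiset \<Rightarrow> (nat \<times> complex) list" where
  "A_zero S =
     replicate (count S (1, 0)) (1, 0) @ replicate (count S (1, 1)) (2, 0) @
     replicate (count S (2, 1)) (3, 0) @ replicate (count S (2, 2)) (4, 0)"

end

theory Submission
  imports Defs
begin

text \<open>
  The form \<open>g(x, y) = [B x, y]\<close> is positive semidefinite, hence Hermitian, and a vector that is null for
  it is annihilated by \<open>B\<close>, because \<open>H\<close> is invertible. Two consequences restrict the Jordan form of
  a square root \<open>A\<close> of \<open>B\<close>.

  Away from zero: an eigenvector \<open>y\<close> of \<open>B\<close> for \<open>\<lambda> \<noteq> 0\<close> satisfies \<open>\<lambda> [y, y] = g(y, y) > 0\<close>, so
  \<open>\<lambda>\<close> is real and \<open>[y, y] \<noteq> 0\<close>. If \<open>A x = \<mu> x + y\<close> and \<open>A y = \<mu> y\<close> with \<open>\<mu> \<noteq> 0\<close>, then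
  \<open>B x = \<mu>\<^sup>2 x + 2 \<mu> y\<close>, and the two evaluations of \<open>[B x, y]\<close>, directly and through the
  symmetry of \<open>g\<close>, differ by \<open>2 \<mu> [y, y]\<close>; so \<open>y = 0\<close>. Hence every Jordan block of \<open>A\<close> at
  \<open>\<mu> \<noteq> 0\<close> has size one, and \<open>\<mu>\<^sup>2\<close> is real (\<open>root_block_nonzero\<close>, \<open>root_block_square_real\<close>).

  At zero: if \<open>B\<^sup>3 x = 0\<close> then \<open>g(B x, B x) = [B\<^sup>3 x, x] = 0\<close>, whence \<open>B\<^sup>2 x = 0\<close>. So
  \<open>A\<^sup>4\<close> and \<open>A\<^sup>5\<close> have the same kernel, and the nilpotent blocks of \<open>A\<close> have size at most four
  (\<open>root_block_zero\<close>).

  The rest is counting. The algebraic multiplicity of \<open>\<lambda> \<noteq> 0\<close> in \<open>B\<close> is the number of blocks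
  \<open>J\<^sub>1(\<mu>)\<close> of \<open>A\<close> with \<open>\<mu>\<^sup>2 = \<lambda>\<close>, so the nonzero eigenvalues of \<open>A\<close> can be matched with the
  listed eigenvalues of \<open>B\<close>, each one being a signed square root of its partner
  (\<open>squares_eq_signed_eigenvalues\<close>, \<open>image_mset_transport\<close>). Squaring turns
  \<open>J\<^sub>1(0)\<close>, \<open>J\<^sub>2(0)\<close>, \<open>J\<^sub>3(0)\<close>, \<open>J\<^sub>4(0)\<close> into \<open>J\<^sub>1\<close>, \<open>J\<^sub>1 \<oplus> J\<^sub>1\<close>,
  \<open>J\<^sub>2 \<oplus> J\<^sub>1\<close>, \<open>J\<^sub>2 \<oplus> J\<^sub>2\<close>. The splitting of the nilpotent blocks of \<open>A\<close> therefore is the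
  Segre pairing (\<open>segre_pairing_root_pairing\<close>). The block sizes of the square are read off from the
  dimensions of kernels, the \<open>k\<close>-th power of \<open>B\<close> being the \<open>2 k\<close>-th power of \<open>A\<close>.
\<close>

section \<open>The semidefinite form of an H-nonnegative matrix\<close>

locale nonneg_form =
  fixes n :: nat and H B :: "complex mat"
  assumes H: "H \<in> carrier_mat n n"
    and H_inv: "invertible_mat H"
    and H_adj: "mat_adjoint H = H"
    and B_nonneg: "H_nonnegative n H B"
begin

abbreviation ip :: "complex vec \<Rightarrow> complex vec \<Rightarrow> complex" where
  "ip x y \<equiv> indef_inner H x y"

lemma B: "B \<in> carrier_mat n n"
  using B_nonneg unfolding H_nonnegative_def by blast

lemma ip_sum:
  assumes "x \<in> carrier_vec n" "y \<in> carrier_vec n"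
  shows "ip x y = (\<Sum>i<n. \<Sum>j<n. H $$ (i, j) * x $ j * cnj (y $ i))"
  using assms H
  by (auto simp: indef_inner_def scalar_prod_def sum_distrib_right atLeast0LessThan
      intro!: sum.cong)

lemma ip_add_left:
  assumes "x \<in> carrier_vec n" "y \<in> carrier_vec n" "z \<in> carrier_vec n"
  shows "ip (x + y) z = ip x z + ip y z"
  using assms by (simp add: ip_sum sum.distrib algebra_simps)

lemma ip_smult_left:
  assumes "x \<in> carrier_vec n" "z \<in> carrier_vec n"
  shows "ip (c \<cdot>\<^sub>v x) z = c * ip x z"
  using assms by (simp add: ip_sum sum_distrib_left algebra_simps)

lemma ip_add_right:
  assumes "x \<in> carrier_vec n" "y \<in> carrier_vec n" "z \<in> carrier_vec n"
  shows "ip z (x + y) = ip z x + ip z y"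
  using assms by (simp add: ip_sum sum.distrib algebra_simps)

lemma ip_smult_right:
  assumes "x \<in> carrier_vec n" "z \<in> carrier_vec n"
  shows "ip z (c \<cdot>\<^sub>v x) = cnj c * ip z x"
  using assms by (simp add: ip_sum sum_distrib_left algebra_simps)

lemma ip_hermitian:
  assumes "x \<in> carrier_vec n" "y \<in> carrier_vec n"
  shows "ip y x = cnj (ip x y)"
proof -
  have H_entry: "cnj (H $$ (i, j)) = H $$ (j, i)" if "i < n" "j < n" for i j
  proof -
    have "H $$ (j, i) = mat_adjoint H $$ (j, i)"
      by (simp add: H_adj)
    also have "\<dots> = cnj (H $$ (i, j))"
      using H that by (simp add: mat_adjoint_def mat_of_rows_index)
    finally show ?thesis by simp
  qed
  have "cnj (ip x y) = (\<Sum>i<n. \<Sum>j<n. H $$ (j, i) * cnj (x $ j) * y $ i)"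
    using assms by (auto simp: ip_sum H_entry intro!: sum.cong)
  also have "\<dots> = ip y x"
    using assms by (subst sum.swap) (auto simp: ip_sum mult_ac intro!: sum.cong)
  finally show ?thesis by simp
qed

lemma ip_nondegenerate:
  assumes x: "x \<in> carrier_vec n" and orth: "\<And>y. y \<in> carrier_vec n \<Longrightarrow> ip x y = 0"
  shows "x = 0\<^sub>v n"
proof -
  have Hx: "H *\<^sub>v x = 0\<^sub>v n"
    using orth[of "H *\<^sub>v x"] H x conjugate_square_eq_0_vec[of "H *\<^sub>v x" n]
    by (simp add: indef_inner_def)
  obtain K where K: "K * H = 1\<^sub>m (dim_row K)" and K': "H * K = 1\<^sub>m (dim_row H)"
    using H_inv unfolding invertible_mat_def inverts_mat_def by blast
  have KC: "K \<in> carrier_mat n n"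
    using arg_cong[OF K, of dim_col] arg_cong[OF K', of dim_col] H by auto
  have "x = (K * H) *\<^sub>v x" using K KC x by simp
  also have "\<dots> = K *\<^sub>v 0\<^sub>v n" using KC H x Hx by simp
  also have "\<dots> = 0\<^sub>v n" using KC by (auto simp: mult_mat_vec_def)
  finally show ?thesis .
qed

lemma B_vec: "x \<in> carrier_vec n \<Longrightarrow> B *\<^sub>v x \<in> carrier_vec n"
  using B by simp

lemma gram_nonneg:
  assumes "x \<in> carrier_vec n"
  shows "Im (ip (B *\<^sub>v x) x) = 0" "Re (ip (B *\<^sub>v x) x) \<ge> 0"
  using assms B_nonneg unfolding H_nonnegative_def
  by (auto simp: complex_nonneg_Reals_iff)

text \<open>
  The values of the quadratic form on the lines \<open>x + c y\<close> determine everything that is needed about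
  it: that they are real for \<open>c = 1\<close> and \<open>c = \<i>\<close> gives symmetry, that they are nonnegative for
  suitable small \<open>c\<close> gives the null vectors.
\<close>

lemma gram_expand:
  assumes x: "x \<in> carrier_vec n" and y: "y \<in> carrier_vec n"
  shows "ip (B *\<^sub>v (x + c \<cdot>\<^sub>v y)) (x + c \<cdot>\<^sub>v y) =
    ip (B *\<^sub>v x) x + c * ip (B *\<^sub>v y) x + cnj c * ip (B *\<^sub>v x) y + c * cnj c * ip (B *\<^sub>v y) y"
proof -
  have "B *\<^sub>v (x + c \<cdot>\<^sub>v y) = B *\<^sub>v x + c \<cdot>\<^sub>v (B *\<^sub>v y)"
    using B x y by (simp add: mult_add_distrib_mat_vec mult_mat_vec)
  then show ?thesis
    using x y B_vec[OF x] B_vec[OF y]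
    by (simp add: ip_add_left ip_add_right ip_smult_left ip_smult_right algebra_simps)
qed

lemma gram_hermitian:
  assumes x: "x \<in> carrier_vec n" and y: "y \<in> carrier_vec n"
  shows "ip (B *\<^sub>v y) x = cnj (ip (B *\<^sub>v x) y)"
proof -
  have "Im (ip (B *\<^sub>v (x + c \<cdot>\<^sub>v y)) (x + c \<cdot>\<^sub>v y)) = 0" for c
    by (rule gram_nonneg) (use x y in simp)
  from this[of 1] this[of \<i>] gram_nonneg(1)[OF x] gram_nonneg(1)[OF y]
  show ?thesis
    unfolding gram_expand[OF x y] by (simp add: complex_eq_iff)
qed

text \<open>
  This is the Cauchy-Schwarz argument. With \<open>b = [B x, y]\<close> the form takes the value
  \<open>|b|\<^sup>2 (s\<^sup>2 d - 2 s)\<close> at \<open>x - s b y\<close>, which is negative for small \<open>s > 0\<close> unless \<open>b = 0\<close>.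
\<close>

lemma gram_null:
  assumes x: "x \<in> carrier_vec n" and null: "ip (B *\<^sub>v x) x = 0"
  shows "B *\<^sub>v x = 0\<^sub>v n"
proof (rule ip_nondegenerate)
  fix y :: "complex vec"
  assume y: "y \<in> carrier_vec n"
  define b where "b = ip (B *\<^sub>v x) y"
  define d where "d = Re (ip (B *\<^sub>v y) y)"
  have d: "d \<ge> 0" "ip (B *\<^sub>v y) y = of_real d"
    using gram_nonneg[OF y] by (auto simp: d_def complex_eq_iff)
  \<comment> \<open>Any \<open>s > 0\<close> with \<open>s d < 2\<close> would do.\<close>
  define s where "s = 1 / (d + 1)"
  have "0 \<le> Re (ip (B *\<^sub>v (x + (- s * b) \<cdot>\<^sub>v y)) (x + (- s * b) \<cdot>\<^sub>v y))"
    by (rule gram_nonneg) (use x y in simp)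
  also have "\<dots> = (cmod b)\<^sup>2 * (s\<^sup>2 * d - 2 * s)"
    unfolding gram_expand[OF x y] null gram_hermitian[OF x y] d(2) b_def[symmetric]
    by (simp add: cmod_power2) (simp add: algebra_simps power2_eq_square)
  finally have "0 \<le> (cmod b)\<^sup>2 * (s\<^sup>2 * d - 2 * s)" .
  moreover have "s\<^sup>2 * d - 2 * s < 0"
  proof -
    have "s\<^sup>2 * d = s * (d / (d + 1))" by (simp add: s_def power2_eq_square)
    also have "\<dots> \<le> s * 1"
      using d(1) by (intro mult_left_mono) (auto simp: s_def)
    finally have "s\<^sup>2 * d \<le> s" by simp
    moreover have "s > 0" using d(1) by (simp add: s_def)
    ultimately show ?thesis by linarith
  qed
  ultimately have "cmod b = 0"
    by (metis mult_pos_neg not_less zero_less_power2)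
  then show "ip (B *\<^sub>v x) y = 0" by (simp add: b_def)
qed (rule B_vec[OF x])

lemma eigenvector_neutral:
  assumes y: "y \<in> carrier_vec n" and By: "B *\<^sub>v y = l \<cdot>\<^sub>v y" and l: "l \<noteq> 0" and "y \<noteq> 0\<^sub>v n"
  shows "ip y y \<noteq> 0"
proof
  assume "ip y y = 0"
  then have "B *\<^sub>v y = 0\<^sub>v n"
    by (intro gram_null y) (simp add: By ip_smult_left y)
  then have "l \<cdot>\<^sub>v y = 0\<^sub>v n" by (simp add: By)
  then have "l * y $ i = 0" if "i < n" for i
    using that y by (metis carrier_vecD index_smult_vec(1) index_zero_vec(1))
  with l y have "y = 0\<^sub>v n" by (intro eq_vecI) auto
  with \<open>y \<noteq> 0\<^sub>v n\<close> show False ..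
qed

lemma eigenvalue_real:
  assumes y: "y \<in> carrier_vec n" and By: "B *\<^sub>v y = l \<cdot>\<^sub>v y" and nz: "y \<noteq> 0\<^sub>v n"
  shows "l \<in> \<real>"
proof (cases "l = 0")
  case False
  have "ip y y \<in> \<real>" using ip_hermitian[OF y y] by (metis Reals_cnj_iff)
  moreover have "l * ip y y \<in> \<real>"
    using gram_nonneg(1)[OF y] by (simp add: By ip_smult_left y complex_is_Real_iff)
  ultimately have "l * ip y y / ip y y \<in> \<real>" by (rule Reals_divide[rotated])
  with eigenvector_neutral[OF y By False nz] show ?thesis by simp
qed simp

text \<open>
  Since \<open>[B x, y]\<close> is the conjugate of \<open>[B y, x]\<close>, it equals \<open>l [x, y]\<close>, whereas inserting the
  formula for \<open>B x\<close> gives \<open>l [x, y] + c [y, y]\<close>. So \<open>y\<close> is neutral, which no eigenvector for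
  a nonzero eigenvalue can be.
\<close>

lemma no_chain_nonzero:
  assumes x: "x \<in> carrier_vec n" and y: "y \<in> carrier_vec n"
    and By: "B *\<^sub>v y = l \<cdot>\<^sub>v y" and Bx: "B *\<^sub>v x = l \<cdot>\<^sub>v x + c \<cdot>\<^sub>v y"
    and l: "l \<noteq> 0" and c: "c \<noteq> 0"
  shows "y = 0\<^sub>v n"
proof (rule ccontr)
  assume nz: "y \<noteq> 0\<^sub>v n"
  have l_real: "cnj l = l"
    using eigenvalue_real[OF y By nz] by (simp add: Reals_cnj_iff)
  have "ip (B *\<^sub>v x) y = cnj (l * ip y x)"
    by (subst gram_hermitian[OF y x]) (simp add: By ip_smult_left x y)
  also have "\<dots> = l * ip x y"
    using ip_hermitian[OF y x] by (simp add: l_real)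
  finally have "c * ip y y = 0"
    using x y by (simp add: Bx ip_add_left ip_smult_left)
  with c eigenvector_neutral[OF y By l nz] show False by simp
qed

text \<open>
  The value of the form at \<open>B x\<close> is \<open>[B\<^sup>3 x, x]\<close>, so \<open>B x\<close> is null for it and hence in the kernel of
  \<open>B\<close>.
\<close>

lemma kernel_cube:
  assumes x: "x \<in> carrier_vec n" and "B *\<^sub>v (B *\<^sub>v (B *\<^sub>v x)) = 0\<^sub>v n"
  shows "B *\<^sub>v (B *\<^sub>v x) = 0\<^sub>v n"
proof (rule gram_null)
  note [simp] = B_vec
  show "ip (B *\<^sub>v (B *\<^sub>v x)) (B *\<^sub>v x) = 0"
  proof -
    have "ip (B *\<^sub>v (B *\<^sub>v x)) (B *\<^sub>v x) = cnj (ip (B *\<^sub>v x) (B *\<^sub>v (B *\<^sub>v x)))"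
      using x by (simp add: ip_hermitian[of "B *\<^sub>v x" "B *\<^sub>v (B *\<^sub>v x)"])
    also have "\<dots> = ip (B *\<^sub>v (B *\<^sub>v (B *\<^sub>v x))) x"
      using gram_hermitian[of x "B *\<^sub>v (B *\<^sub>v x)"] x by simp
    also have "\<dots> = 0"
      using ip_sum[of "0\<^sub>v n" x] assms by simp
    finally show ?thesis .
  qed
qed (simp add: B_vec x)

end

section \<open>Powers of matrices and their Jordan blocks\<close>

lemma pow_mat_add:
  assumes A: "A \<in> carrier_mat n n"
  shows "A ^\<^sub>m (k + l) = A ^\<^sub>m k * A ^\<^sub>m l"
proof (induction l)
  case 0
  then show ?case using A by simp
next
  case (Suc l)
  then show ?case
    using A by (simp add: assoc_mult_mat[of _ n n _ n _ n])
qed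

lemma pow_mat_mult:
  assumes A: "A \<in> carrier_mat n n"
  shows "(A ^\<^sub>m k) ^\<^sub>m l = A ^\<^sub>m (k * l)"
proof (induction l)
  case 0
  then show ?case using A by simp
next
  case (Suc l)
  then have "(A ^\<^sub>m k) ^\<^sub>m Suc l = A ^\<^sub>m (k * l + k)"
    by (simp add: pow_mat_add[OF A])
  then show ?case by (simp add: add.commute)
qed

lemma char_matrix_zero:
  assumes "A \<in> carrier_mat n n"
  shows "char_matrix A 0 = A"
  using assms by (intro eq_matI) (auto simp: char_matrix_def)

lemma char_matrix_mult_vec:
  assumes A: "A \<in> carrier_mat n n" and x: "x \<in> carrier_vec n"
  shows "char_matrix A e *\<^sub>v x = A *\<^sub>v x - e \<cdot>\<^sub>v x"
  unfolding char_matrix_def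
  using A x by (intro eq_vecI) (auto simp: add_scalar_prod_distrib[of _ n])

lemma kernel_dim_cong:
  assumes "M \<in> carrier_mat n n" "N \<in> carrier_mat n n" "mat_kernel M = mat_kernel N"
  shows "kernel_dim M = kernel_dim N"
  using assms by (simp add: kernel_dim_def)

text \<open>
  A block of size \<open>k\<close> contributes \<open>min s k\<close> to the dimension of the \<open>s\<close>-th generalized eigenspace, so
  a block larger than \<open>s\<close> makes the next one strictly larger.
\<close>

lemma jordan_block_size_le:
  assumes jnf: "jordan_nf A n_as" and mem: "(k, e) \<in> set n_as"
    and stable: "dim_gen_eigenspace A e (Suc s) = dim_gen_eigenspace A e s"
  shows "k \<le> s"
proof (rule ccontr)
  assume "\<not> k \<le> s"
  have less: "(\<Sum>m\<leftarrow>ms. min s m) < (\<Sum>m\<leftarrow>ms. min (Suc s) m)" if "k \<in> set ms" for ms :: "nat list"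
    using that
  proof (induction ms)
    case (Cons m ms)
    have "(\<Sum>m\<leftarrow>ms. min s m) \<le> (\<Sum>m\<leftarrow>ms. min (Suc s) m)"
      by (rule sum_list_mono) auto
    with Cons \<open>\<not> k \<le> s\<close> show ?case by (cases "k = m") auto
  qed simp
  have "k \<in> set (map fst [(n, e') \<leftarrow> n_as. e' = e])"
    using mem by force
  from less[OF this] stable show False
    by (simp add: dim_gen_eigenspace[OF jnf])
qed

lemma dim_gen_eigenspace_pow_zero:
  assumes A: "A \<in> carrier_mat n n"
  shows "dim_gen_eigenspace (A ^\<^sub>m r) 0 k = dim_gen_eigenspace A 0 (r * k)"
  using A by (simp add: dim_gen_eigenspace_def char_matrix_zero[of _ n] pow_mat_mult)

text \<open>
  The \<open>r\<close>-th power of the Jordan matrix is upper triangular, with \<open>k\<close> diagonal entries \<open>a ^ r\<close> for each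
  block \<open>J\<^sub>k(a)\<close>; the power itself is in general not in Jordan form.
\<close>

lemma char_poly_pow_jordan_nf:
  fixes A :: "'a :: field mat"
  assumes A: "A \<in> carrier_mat n n" and jnf: "jordan_nf A n_as"
  shows "char_poly (A ^\<^sub>m r) = (\<Prod>(k, a)\<leftarrow>n_as. [:- (a ^ r), 1:] ^ k)"
proof -
  let ?J = "jordan_matrix n_as ^\<^sub>m r"
  let ?blocks = "map (\<lambda>(k, a). jordan_block k a ^\<^sub>m r) n_as"
  have J: "?J \<in> carrier_mat (sum_list (map fst n_as)) (sum_list (map fst n_as))"
    by simp
  have "similar_mat (A ^\<^sub>m r) ?J"
    using jnf similar_mat_wit_pow unfolding jordan_nf_def similar_mat_def by blast
  then have "char_poly (A ^\<^sub>m r) = char_poly ?J"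
    by (rule char_poly_similar)
  also have "upper_triangular ?J"
  proof (rule upper_triangularI)
    fix i j
    assume ij: "j < i" "i < dim_row ?J"
    show "?J $$ (i, j) = 0"
      unfolding jordan_matrix_pow
      by (rule diag_block_upper_triangular)
        (use ij in \<open>auto simp: jordan_block_pow jordan_matrix_pow\<close>)
  qed
  from char_poly_upper_triangular[OF J this]
  have "char_poly ?J = (\<Prod>a\<leftarrow>diag_mat ?J. [:- a, 1:])" .
  also have "diag_mat ?J = concat (map (\<lambda>(k, a). replicate k (a ^ r)) n_as)"
    unfolding jordan_matrix_pow
  proof (induction n_as)
    case Nil
    then show ?case by (simp add: diag_mat_def)
  next
    case (Cons ka n_as)
    obtain k a where ka: "ka = (k, a)" by force
    let ?D = "diag_block_mat (map (\<lambda>(k, a). jordan_block k a ^\<^sub>m r) n_as)"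
    have D: "?D \<in> carrier_mat (sum_list (map fst n_as)) (sum_list (map fst n_as))"
      by (simp add: jordan_matrix_pow[symmetric])
    have "diag_mat (diag_block_mat (map (\<lambda>(k, a). jordan_block k a ^\<^sub>m r) (ka # n_as))) =
        diag_mat (jordan_block k a ^\<^sub>m r) @ diag_mat ?D"
      unfolding ka list.map prod.case diag_block_mat.simps Let_def
      by (rule diag_four_block_mat[OF pow_carrier_mat[OF jordan_block_carrier] D])
    then show ?case
      by (simp only: Cons.IH ka list.map prod.case concat.simps diag_jordan_block_pow)
  qed
  also have "(\<Prod>a\<leftarrow>concat (map (\<lambda>(k, a). replicate k (a ^ r)) n_as). [:- a, 1:]) =
      (\<Prod>(k, a)\<leftarrow>n_as. [:- (a ^ r), 1:] ^ k)"
    by (induction n_as) auto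
  finally show ?thesis .
qed

lemma order_char_poly_pow_jordan_nf:
  fixes A :: "'a :: field mat"
  assumes A: "A \<in> carrier_mat n n" and jnf: "jordan_nf A n_as"
  shows "Polynomial.order x (char_poly (A ^\<^sub>m r)) = (\<Sum>(k, a)\<leftarrow>n_as. if a ^ r = x then k else 0)"
  unfolding char_poly_pow_jordan_nf[OF A jnf]
proof (induction n_as)
  case (Cons ka n_as)
  obtain k a where ka: "ka = (k, a)" by force
  have "[:- (a ^ r), 1:] ^ k * (\<Prod>(k, a)\<leftarrow>n_as. [:- (a ^ r), 1:] ^ k) \<noteq> 0"
    by (auto simp: prod_list_zero_iff)
  from order_mult[OF this, of x] show ?case
    using Cons.IH by (auto simp: ka order_linear_power)
qed simp

definition zero_sizes :: "(nat \<times> complex) list \<Rightarrow> nat list" where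
  "zero_sizes n_as = map fst (filter (\<lambda>b. snd b = 0) n_as)"

lemma count_zero_sizes: "count (mset (zero_sizes n_as)) k = count (mset n_as) (k, 0)"
  unfolding zero_sizes_def by (induction n_as) auto

text \<open>
  The number of blocks of size \<open>k\<close> is minus the second difference of the dimensions of the kernels of the
  powers, and the kernel of the \<open>j\<close>-th power of \<open>A ^\<^sub>m 2\<close> is that of the \<open>2 * j\<close>-th power of \<open>A\<close>.
\<close>

lemma count_segre_char_square:
  fixes A :: "complex mat" and n_as
  assumes A: "A \<in> carrier_mat n n" and jnf: "jordan_nf A n_as" and k: "k > 0"
  defines "D \<equiv> \<lambda>j. \<Sum>m\<leftarrow>zero_sizes n_as. min j m"
  shows "count (mset (segre_char (A ^\<^sub>m 2))) k = 2 * D (2 * k) - D (2 * (k - 1)) - D (2 * Suc k)"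
proof -
  have A2: "A ^\<^sub>m 2 \<in> carrier_mat n n" using A by simp
  obtain m_bs where B: "jordan_nf (A ^\<^sub>m 2) m_bs"
    using char_poly_factorized[OF A2] jordan_nf_exists[OF A2] by blast
  have D: "dim_gen_eigenspace (A ^\<^sub>m 2) 0 j = D (2 * j)" for j
    unfolding dim_gen_eigenspace_pow_zero[OF A] dim_gen_eigenspace[OF jnf] D_def zero_sizes_def
    by (simp add: split_def)
  have "count (mset (segre_char (A ^\<^sub>m 2))) k = count (mset (zero_sizes m_bs)) k"
    by (simp add: segre_char_eq[OF B] zero_block_sizes_def zero_sizes_def)
  also have "\<dots> = length (filter ((=) (k, 0)) m_bs)"
    unfolding count_zero_sizes by (induction m_bs) auto
  also have "\<dots> = compute_nr_of_jordan_blocks (A ^\<^sub>m 2) 0 k"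
    using k by (simp add: compute_nr_of_jordan_blocks[OF B])
  finally show ?thesis
    by (simp add: compute_nr_of_jordan_blocks_def D)
qed

lemma segre_char_pos: 
  assumes "A \<in> carrier_mat n n"
  shows "0 \<notin> set (segre_char A)"
proof -
  obtain n_as where jnf: "jordan_nf A n_as"
    using char_poly_factorized[OF assms] jordan_nf_exists[OF assms] by blast
  then show ?thesis
    by (force simp: segre_char_eq[OF jnf] zero_block_sizes_def jordan_nf_def)
qed

section \<open>Reordering Jordan blocks\<close>

text \<open>
  The similarity is the block permutation that exchanges the two summands.
\<close>

lemma similar_mat_four_block_swap:
  fixes A B :: "'a :: comm_ring_1 mat"
  assumes A: "A \<in> carrier_mat n n" and B: "B \<in> carrier_mat m m"
  shows "similar_mat (four_block_mat A (0\<^sub>m n m) (0\<^sub>m m n) B)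
    (four_block_mat B (0\<^sub>m m n) (0\<^sub>m n m) A)"
proof -
  let ?P = "four_block_mat (0\<^sub>m n m) (1\<^sub>m n) (1\<^sub>m m) (0\<^sub>m m n) :: 'a mat"
  let ?Q = "four_block_mat (0\<^sub>m m n) (1\<^sub>m m) (1\<^sub>m n) (0\<^sub>m n m) :: 'a mat"
  let ?AB = "four_block_mat A (0\<^sub>m n m) (0\<^sub>m m n) B"
  let ?BA = "four_block_mat B (0\<^sub>m m n) (0\<^sub>m n m) A"
  have PB: "?P * ?BA = four_block_mat (0\<^sub>m n m) A B (0\<^sub>m m n)"
    using A B by (subst mult_four_block_mat[of _ n m _ n _ m _ _ m _ n]) auto
  have "?P * ?Q = 1\<^sub>m (n + m)"
    by (subst mult_four_block_mat[of _ n m _ n _ m _ _ n _ m]) auto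
  moreover have "?Q * ?P = 1\<^sub>m (n + m)"
    by (subst mult_four_block_mat[of _ m n _ m _ n _ _ m _ n]) (auto simp: add.commute[of n])
  moreover have "?AB = ?P * ?BA * ?Q"
    unfolding PB
    using A B by (subst mult_four_block_mat[of _ n m _ n _ m _ _ n _ m]) auto
  ultimately have "similar_mat_wit ?AB ?BA ?P ?Q"
    using A B by (intro similar_mat_witI[of _ _ "n + m"]) (auto simp: add.commute[of m])
  then show ?thesis unfolding similar_mat_def by blast
qed

lemma jordan_matrix_append:
  "jordan_matrix (xs @ ys) = four_block_mat (jordan_matrix xs)
     (0\<^sub>m (sum_list (map fst xs)) (sum_list (map fst ys)))
     (0\<^sub>m (sum_list (map fst ys)) (sum_list (map fst xs))) (jordan_matrix ys)"
  using jordan_matrix_dim[of xs] jordan_matrix_dim[of ys]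
  by (simp add: jordan_matrix_def diag_block_mat_append Let_def)

lemma similar_jordan_matrix_mset:
  fixes xs ys :: "(nat \<times> 'a :: comm_ring_1) list"
  assumes "mset xs = mset ys"
  shows "similar_mat (jordan_matrix xs) (jordan_matrix ys)"
  using assms
proof (induction xs arbitrary: ys)
  case Nil
  then show ?case by (auto intro: similar_mat_refl[of _ 0] jordan_matrix_carrier[of "[]", simplified])
next
  case (Cons a xs)
  then have "a \<in> set ys" by (metis list.set_intros(1) set_mset_mset)
  then obtain us vs where ys: "ys = us @ a # vs" by (auto simp: in_set_conv_decomp)
  with Cons.prems have "mset xs = mset (vs @ us)" by simp
  moreover from this have "sum_list (map fst (vs @ us)) = sum_list (map fst xs)"
    by (metis mset_map sum_mset_sum_list)
  ultimately have "similar_mat (jordan_matrix ([a] @ xs)) (jordan_matrix ([a] @ vs @ us))"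
    unfolding jordan_matrix_append[of "[a]"]
    by (auto intro!: similar_mat_four_block_0_0 similar_mat_refl Cons.IH)
  moreover have "similar_mat (jordan_matrix ((a # vs) @ us)) (jordan_matrix (us @ a # vs))"
    unfolding jordan_matrix_append by (intro similar_mat_four_block_swap jordan_matrix_carrier)
  ultimately show ?case
    unfolding ys using similar_mat_trans by fastforce
qed

lemma jordan_nf_mset_cong:
  fixes A :: "'a :: comm_ring_1 mat"
  assumes "jordan_nf A xs" "mset xs = mset ys"
  shows "jordan_nf A ys"
  using assms similar_mat_trans[OF _ similar_jordan_matrix_mset[OF assms(2)], of A]
    mset_eq_setD[OF assms(2)]
  unfolding jordan_nf_def by auto

section \<open>Jordan blocks of a square root\<close>

definition nonzero_roots :: "(nat \<times> complex) list \<Rightarrow> complex multiset" where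
  "nonzero_roots n_as = mset (map snd (filter (\<lambda>b. snd b \<noteq> 0) n_as))"

locale nonneg_form_root = nonneg_form +
  fixes A :: "complex mat"
  assumes A: "A \<in> carrier_mat n n" and A_square: "A ^\<^sub>m 2 = B"
begin

lemma root_vec: "x \<in> carrier_vec n \<Longrightarrow> A *\<^sub>v x \<in> carrier_vec n"
  using A by simp

lemma square_mult_vec:
  assumes "x \<in> carrier_vec n"
  shows "B *\<^sub>v x = A *\<^sub>v (A *\<^sub>v x)"
  using assms A by (simp add: A_square[symmetric] numeral_2_eq_2)

text \<open>
  If \<open>A - a\<close> had a kernel smaller than its square, then \<open>x\<close> in the difference and \<open>y = A x - a x\<close> would
  form a chain for \<open>B\<close> at \<open>a\<^sup>2\<close> with coefficient \<open>2 a\<close>.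
\<close>

lemma root_block_nonzero:
  assumes jnf: "jordan_nf A n_as" and mem: "(k, a) \<in> set n_as" and a: "a \<noteq> 0"
  shows "k = 1" 
proof -
  let ?C = "char_matrix A a"
  have C: "?C \<in> carrier_mat n n" using A by simp
  have kernel: "?C *\<^sub>v x = 0\<^sub>v n"
    if x: "x \<in> carrier_vec n" and null: "?C *\<^sub>v (?C *\<^sub>v x) = 0\<^sub>v n" for x
  proof -
    define y where "y = ?C *\<^sub>v x"
    have y: "y \<in> carrier_vec n" unfolding y_def using C x by simp
    have Ay: "A *\<^sub>v y = a \<cdot>\<^sub>v y"
    proof -
      have "A *\<^sub>v y - a \<cdot>\<^sub>v y = 0\<^sub>v n"
        using null by (simp add: y_def[symmetric] char_matrix_mult_vec[OF A y])
      from arg_cong[OF this, of "\<lambda>v. v $ i" for i]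
      have "(A *\<^sub>v y - a \<cdot>\<^sub>v y) $ i = 0\<^sub>v n $ i" for i .
      then have "(A *\<^sub>v y) $ i = a * y $ i" if "i < n" for i
        using that y A by (metis (no_types, lifting) carrier_vecD eq_iff_diff_eq_0
            index_minus_vec(1) index_smult_vec index_zero_vec(1))
      then show ?thesis using y A by (intro eq_vecI) auto
    qed
    have Ax: "A *\<^sub>v x = a \<cdot>\<^sub>v x + y"
      unfolding y_def char_matrix_mult_vec[OF A x]
      using x root_vec[OF x] by (intro eq_vecI) (use A in auto)
    have By: "B *\<^sub>v y = a\<^sup>2 \<cdot>\<^sub>v y"
      using y A by (simp add: square_mult_vec Ay mult_mat_vec smult_smult_assoc power2_eq_square)
    have Bx: "B *\<^sub>v x = a\<^sup>2 \<cdot>\<^sub>v x + (2 * a) \<cdot>\<^sub>v y"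
    proof -
      have "B *\<^sub>v x = a \<cdot>\<^sub>v (a \<cdot>\<^sub>v x + y) + a \<cdot>\<^sub>v y"
        using x y A by (simp add: square_mult_vec Ax Ay mult_add_distrib_mat_vec mult_mat_vec)
      also have "\<dots> = a\<^sup>2 \<cdot>\<^sub>v x + (2 * a) \<cdot>\<^sub>v y"
        using x y by (intro eq_vecI) (auto simp: power2_eq_square algebra_simps)
      finally show ?thesis .
    qed
    show "?C *\<^sub>v x = 0\<^sub>v n"
      using no_chain_nonzero[OF x y By Bx] a by (simp add: y_def)
  qed
  have C_pow: "?C ^\<^sub>m Suc 1 \<in> carrier_mat n n" "?C ^\<^sub>m 1 \<in> carrier_mat n n"
    using C by simp_all
  have "mat_kernel (?C ^\<^sub>m Suc 1) = mat_kernel (?C ^\<^sub>m 1)"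
    unfolding mat_kernel[OF C_pow(1)] mat_kernel[OF C_pow(2)]
    using C kernel by auto
  then have "dim_gen_eigenspace A a (Suc 1) = dim_gen_eigenspace A a 1"
    unfolding dim_gen_eigenspace_def by (rule kernel_dim_cong[OF C_pow])
  from jordan_block_size_le[OF jnf mem this] show "k = 1"
    using jnf mem unfolding jordan_nf_def by force
qed

text \<open>
  The bound is four because \<open>A ^\<^sub>m 5\<close> and \<open>A ^\<^sub>m 4\<close> lie between \<open>B\<^sup>3\<close> and \<open>B\<^sup>2\<close>, whose kernels agree.
\<close>

lemma root_block_zero:
  assumes jnf: "jordan_nf A n_as" and mem: "(k, 0) \<in> set n_as"
  shows "k \<le> 4"
proof -
  have "A ^\<^sub>m 4 = B * B" "A ^\<^sub>m Suc 4 = A * (B * B)"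
    using pow_mat_add[OF A, of 2 2] pow_mat_add[OF A, of 1 4] A by (simp_all add: A_square)
  then have pow4: "A ^\<^sub>m 4 *\<^sub>v x = B *\<^sub>v (B *\<^sub>v x)" and
    pow5: "A ^\<^sub>m Suc 4 *\<^sub>v x = A *\<^sub>v (B *\<^sub>v (B *\<^sub>v x))" if x: "x \<in> carrier_vec n" for x
    using A B x by (simp_all add: assoc_mult_mat_vec[of _ n n _ n])
  have kernel: "A ^\<^sub>m Suc 4 *\<^sub>v x = 0\<^sub>v n \<longleftrightarrow> A ^\<^sub>m 4 *\<^sub>v x = 0\<^sub>v n"
    if x: "x \<in> carrier_vec n" for x
  proof -
    have A0: "A *\<^sub>v 0\<^sub>v n = 0\<^sub>v n" using A by auto
    show ?thesis
      unfolding pow4[OF x] pow5[OF x]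
      using kernel_cube[OF x] square_mult_vec[of "B *\<^sub>v (B *\<^sub>v x)"] A0 B_vec x by auto
  qed
  have A_pow: "A ^\<^sub>m Suc 4 \<in> carrier_mat n n" "A ^\<^sub>m 4 \<in> carrier_mat n n"
    using A by (simp_all del: pow_mat.simps)
  have "mat_kernel (A ^\<^sub>m Suc 4) = mat_kernel (A ^\<^sub>m 4)"
    unfolding mat_kernel[OF A_pow(1)] mat_kernel[OF A_pow(2)] using kernel by blast
  then have "dim_gen_eigenspace A 0 (Suc 4) = dim_gen_eigenspace A 0 4"
    unfolding dim_gen_eigenspace_def char_matrix_zero[OF A] by (rule kernel_dim_cong[OF A_pow])
  from jordan_block_size_le[OF jnf mem this] show ?thesis .
qed

lemma root_block_square_real:
  assumes jnf: "jordan_nf A n_as" and mem: "(k, a) \<in> set n_as"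
  shows "a\<^sup>2 \<in> \<real>"
proof -
  have "poly (char_poly A) a = 0"
    using jordan_nf_char_poly[OF jnf] mem jnf
    by (force simp: jordan_nf_def poly_prod_list prod_list_zero_iff)
  then obtain x where x: "x \<in> carrier_vec n" "x \<noteq> 0\<^sub>v n" "A *\<^sub>v x = a \<cdot>\<^sub>v x"
    using A by (auto simp: eigenvalue_root_char_poly[OF A, symmetric] eigenvalue_def eigenvector_def)
  have "B *\<^sub>v x = a\<^sup>2 \<cdot>\<^sub>v x"
    using x A by (simp add: square_mult_vec mult_mat_vec smult_smult_assoc power2_eq_square)
  from eigenvalue_real[OF x(1) this x(2)] show ?thesis .
qed

text \<open>
  Both sides list the nonzero eigenvalues of \<open>B\<close> with their algebraic multiplicities; on the left a
  block counts once, because it has size one.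
\<close>

lemma squares_eq_signed_eigenvalues:
  assumes jnf: "jordan_nf A n_as" and ev: "signed_eigenvalues B q r ev"
  shows "image_mset (\<lambda>a. a\<^sup>2) (nonzero_roots n_as) =
    image_mset (\<lambda>j. complex_of_real (ev j)) (mset_set {1..r})"
proof (rule multiset_eqI)
  fix x :: complex
  let ?L = "image_mset (\<lambda>a. a\<^sup>2) (nonzero_roots n_as)"
  let ?R = "image_mset (\<lambda>j. complex_of_real (ev j)) (mset_set {1..r})"
  have L: "count ?L x = Polynomial.order x (char_poly B)" if "x \<noteq> 0"
  proof -
    have "\<forall>(k, a)\<in>set n_as. a \<noteq> 0 \<longrightarrow> k = 1"
      using root_block_nonzero[OF jnf] by blast
    then have "count ?L x = (\<Sum>(k, a)\<leftarrow>n_as. if a\<^sup>2 = x then k else 0)"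
      unfolding nonzero_roots_def using \<open>x \<noteq> 0\<close> by (induction n_as) auto
    then show ?thesis
      by (simp add: order_char_poly_pow_jordan_nf[OF A jnf] flip: A_square)
  qed
  have ev_nz: "ev j \<noteq> 0" if "j \<in> {1..r}" for j
    using ev that unfolding signed_eigenvalues_def
    by (metis Suc_eq_plus1 atLeastAtMost_iff less_irrefl not_less_eq_eq)
  show "count ?L x = count ?R x"
  proof (cases "x \<in> \<real> \<and> x \<noteq> 0")
    case True
    then obtain t where t: "x = complex_of_real t" "t \<noteq> 0" by (auto elim: Reals_cases)
    have "count ?R x = card {j \<in> {1..r}. ev j = t}"
      by (simp add: count_image_mset_eq_card_vimage t)
    also have "\<dots> = Polynomial.order x (char_poly B)"
      using ev t unfolding signed_eigenvalues_def by blast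
    finally show ?thesis using L True by simp
  next
    case False
    then have "x \<notin># ?L"
      using root_block_square_real[OF jnf] by (auto simp: nonzero_roots_def)
    moreover have "x \<notin># ?R"
      using False ev_nz by auto
    ultimately show ?thesis by (simp only: not_in_iff)
  qed
qed

end

section \<open>The Segre pairing of a square root\<close>

lemma mset_replicate_size_counts:
  assumes "set ms \<subseteq> {1..4::nat}"
  shows "mset ms = mset (replicate (count (mset ms) 1) 1 @ replicate (count (mset ms) 2) 2 @
    replicate (count (mset ms) 3) 3 @ replicate (count (mset ms) 4) 4)"
proof (rule multiset_eqI)
  fix k
  have "k \<in> {1, 2, 3, 4} \<or> k \<notin> set ms" using assms by fastforce
  then show "count (mset ms) k = count (mset (replicate (count (mset ms) 1) 1 @
      replicate (count (mset ms) 2) 2 @ replicate (count (mset ms) 3) 3 @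
      replicate (count (mset ms) 4) 4)) k"
    by (auto simp: count_list_0_iff)
qed

context nonneg_form_root
begin

text \<open>
  A nilpotent block of size \<open>m\<close> is assigned the pair formed by the ceiling and the floor of \<open>m / 2\<close>, which
  are the sizes of the blocks into which its square decomposes.
\<close>

definition root_pairing :: "(nat \<times> complex) list \<Rightarrow> (nat \<times> nat) multiset" where
  "root_pairing n_as = (let c = count (mset (zero_sizes n_as)) in
     replicate_mset (c 1) (1, 0) + replicate_mset (c 2) (1, 1) +
     replicate_mset (c 3) (2, 1) + replicate_mset (c 4) (2, 2))"

lemma zero_sizes_bounds:
  assumes jnf: "jordan_nf A n_as"
  shows "set (zero_sizes n_as) \<subseteq> {1..4}"
proof
  fix k
  assume "k \<in> set (zero_sizes n_as)"
  then have mem: "(k, 0) \<in> set n_as" by (auto simp: zero_sizes_def)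
  then have "k \<noteq> 0" using jnf unfolding jordan_nf_def by force
  with root_block_zero[OF jnf mem] show "k \<in> {1..4}" by simp
qed

lemma mset_A_zero_root_pairing:
  assumes jnf: "jordan_nf A n_as"
  shows "mset (A_zero (root_pairing n_as)) = filter_mset (\<lambda>b. snd b = 0) (mset n_as)"
proof -
  have "filter_mset (\<lambda>b. snd b = 0) (mset n_as) = image_mset (\<lambda>k. (k, 0)) (mset (zero_sizes n_as))"
    unfolding zero_sizes_def by (induction n_as) auto
  also have "\<dots> = mset (A_zero (root_pairing n_as))"
    by (subst mset_replicate_size_counts[OF zero_sizes_bounds[OF jnf]])
      (simp add: A_zero_def root_pairing_def Let_def)
  finally show ?thesis by simp
qed

text \<open>
  With \<open>c m\<close> nilpotent blocks of size \<open>m\<close> in \<open>A\<close>, the second differences give \<open>B\<close> exactly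
  \<open>c 1 + 2 c 2 + c 3\<close> blocks of size one, \<open>c 3 + 2 c 4\<close> of size two and none beyond, which are the
  numbers of entries in the pairs.
\<close>

lemma segre_pairing_root_pairing:
  assumes jnf: "jordan_nf A n_as"
  shows "segre_pairing B (root_pairing n_as)"
proof -
  let ?S = "root_pairing n_as"
  let ?c = "count (mset (zero_sizes n_as))"
  define D where "D j = (\<Sum>m\<leftarrow>zero_sizes n_as. min j m)" for j
  have D: "D j = ?c 1 * min j 1 + ?c 2 * min j 2 + ?c 3 * min j 3 + ?c 4 * min j 4" for j
  proof -
    have "D j = (\<Sum>m\<in>#mset (zero_sizes n_as). min j m)"
      unfolding D_def by (metis mset_map sum_mset_sum_list)
    also have "\<dots> = (\<Sum>m\<in>#mset (replicate (?c 1) 1 @ replicate (?c 2) 2 @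
        replicate (?c 3) 3 @ replicate (?c 4) 4). min j m)"
      by (rule arg_cong[OF mset_replicate_size_counts[OF zero_sizes_bounds[OF jnf]]])
    finally show ?thesis by simp
  qed
  have entries: "filter_mset (\<lambda>k. k \<noteq> 0) (image_mset fst ?S + image_mset snd ?S) = mset (segre_char B)"
  proof (rule multiset_eqI)
    fix k
    show "count (filter_mset (\<lambda>k. k \<noteq> 0) (image_mset fst ?S + image_mset snd ?S)) k =
        count (mset (segre_char B)) k"
    proof (cases "k = 0")
      case True
      then show ?thesis
        using segre_char_pos[OF B] by (simp add: count_list_0_iff)
    next
      case False
      have "count (mset (segre_char B)) k = 2 * D (2 * k) - D (2 * (k - 1)) - D (2 * Suc k)"
        using count_segre_char_square[OF A jnf, of k] False by (simp add: A_square D_def)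
      also have "\<dots> = (if k = 1 then ?c 1 + 2 * ?c 2 + ?c 3 else if k = 2 then ?c 3 + 2 * ?c 4 else 0)"
      proof -
        \<comment> \<open>Beyond the largest block size the kernels stop growing.\<close>
        have D_large: "D j = ?c 1 + ?c 2 * 2 + ?c 3 * 3 + ?c 4 * 4" if "j \<ge> 4" for j
          using that by (simp add: D min_absorb2)
        consider "k = 1" | "k = 2" | "k \<ge> 3" using False by linarith
        then show ?thesis
        proof cases
          assume "k \<ge> 3"
          then show ?thesis by (simp add: D_large)
        qed (simp_all add: D)
      qed
      finally show ?thesis
        using False by (simp add: root_pairing_def Let_def)
    qed
  qed
  have first: "a \<in> set (segre_char B)" and second: "b \<in> set (segre_char B) \<union> {0}"
    if "(a, b) \<in># ?S" for a b
  proof -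
    have "a \<in># image_mset fst ?S" "b \<in># image_mset snd ?S"
      using that by force+
    moreover have "a \<noteq> 0"
      using that by (auto simp: root_pairing_def Let_def split: if_splits)
    ultimately have "a \<in># mset (segre_char B)" "b \<noteq> 0 \<longrightarrow> b \<in># mset (segre_char B)"
      unfolding entries[symmetric] by auto
    then show "a \<in> set (segre_char B)" "b \<in> set (segre_char B) \<union> {0}" by auto
  qed
  have "a \<ge> b \<and> \<bar>int a - int b\<bar> \<le> 1" if "(a, b) \<in># ?S" for a b
    using that by (auto simp: root_pairing_def Let_def split: if_splits)
  with first second entries show ?thesis
    unfolding segre_pairing_def by blast
qed

end

section \<open>Matching the nonzero eigenvalues with signs\<close>

text \<open>
  Two families with the same multiset of values can be matched so that matched members have equal values.
  Applied to the squares of the eigenvalues of \<open>A\<close> and to the eigenvalues of \<open>B\<close>, it chooses for each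
  listed eigenvalue of \<open>B\<close> the square root that \<open>A\<close> uses.
\<close>

lemma image_mset_transport:
  fixes g :: "'i \<Rightarrow> 'c"
  assumes "finite I" and "image_mset f M = image_mset g (mset_set I)"
  shows "\<exists>h. image_mset h (mset_set I) = M \<and> (\<forall>i\<in>I. f (h i) = g i)"
  using assms
proof (induction I arbitrary: M rule: finite_induct)
  case empty
  then show ?case by simp
next
  case (insert i I)
  then have "g i \<in># image_mset f M" by simp
  then obtain m where m: "m \<in># M" "f m = g i" by auto
  then have "image_mset f (M - {#m#}) = image_mset g (mset_set I)"
    using insert by (simp add: image_mset_Diff)
  from insert.IH[OF this] obtain h where
    h: "image_mset h (mset_set I) = M - {#m#}" "\<forall>j\<in>I. f (h j) = g j" by blast
  have "image_mset (h(i := m)) (mset_set I) = image_mset h (mset_set I)"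
    using insert.hyps by (intro image_mset_cong) auto
  then show ?case
    using h m insert.hyps by (intro exI[of _ "h(i := m)"]) (auto simp del: fun_upd_apply, auto)
qed
lemma sqrt_sign_choice:
  assumes "z\<^sup>2 = complex_of_real t"
  shows "\<exists>d\<in>{1, -1 :: real}.
    (t > 0 \<longrightarrow> z = complex_of_real (d * sqrt t)) \<and>
    (t < 0 \<longrightarrow> z = \<i> * complex_of_real (d * sqrt (- t)))"
proof -
  define w where "w = (if t > 0 then complex_of_real (sqrt t) else \<i> * complex_of_real (sqrt (- t)))"
  have "w\<^sup>2 = complex_of_real t"
    by (auto simp: w_def power_mult_distrib simp flip: of_real_power)
  with assms have "z\<^sup>2 = w\<^sup>2" by simp
  then have "z = w \<or> z = - w" by (simp only: power2_eq_iff)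
  then show ?thesis by (auto simp: w_def)
qed

lemma mset_A_plus_minus:
  assumes "q \<le> r"
    and plus: "\<And>j. j \<in> {1..q} \<Longrightarrow> h j = complex_of_real (\<delta> j * sqrt (ev j))"
    and minus: "\<And>j. j \<in> {q+1..r} \<Longrightarrow> h j = \<i> * complex_of_real (\<delta> j * sqrt (- ev j))"
  shows "mset (A_minus q r ev \<delta>) + mset (A_plus q ev \<delta>) =
    image_mset (\<lambda>j. (1, h j)) (mset_set {1..r})"
proof -
  have "A_minus q r ev \<delta> = map (\<lambda>j. (1, h (j + q))) [1..<(r - q) + 1]"
    unfolding A_minus_def using assms(1) by (auto simp: minus add.commute)
  also have "\<dots> = map (\<lambda>j. (1, h j)) (map (\<lambda>j. j + q) [1..<(r - q) + 1])" by simp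
  also have "map (\<lambda>j. j + q) [1..<(r - q) + 1] = [1 + q..<(r - q) + 1 + q]"
    by (intro nth_equalityI) (auto simp del: upt_Suc)
  finally have "A_minus q r ev \<delta> = map (\<lambda>j. (1, h j)) [q + 1..<r + 1]"
    using assms(1) by (simp del: upt_Suc)
  moreover have "A_plus q ev \<delta> = map (\<lambda>j. (1, h j)) [1..<q + 1]"
    unfolding A_plus_def by (auto simp: plus)
  moreover have "mset [q + 1..<r + 1] + mset [1..<q + 1] = mset_set {1..r}"
  proof -
    have "{1..r} = {q+1..<r+1} \<union> {1..<q+1}" using assms(1) by auto
    then show ?thesis
      by (simp only: mset_upt) (simp add: mset_set_Union)
  qed
  ultimately show ?thesis
    by (metis image_mset_union mset_map)
qed

theorem theorem3p6:
  fixes n q r :: nat and H B A :: "complex mat" and ev :: "nat \<Rightarrow> real"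
  assumes "H \<in> carrier_mat n n" and "invertible_mat H" and "mat_adjoint H = H"
    and "H_nonnegative n H B"
    and "signed_eigenvalues B q r ev"
    and "square_root_of n B A"
  shows "\<exists>(\<delta> :: nat \<Rightarrow> real) S.
           (\<forall>j \<in> {1..r}. \<delta> j \<in> {1, -1}) \<and> segre_pairing B S \<and>
           jordan_nf A (A_minus q r ev \<delta> @ A_zero S @ A_plus q ev \<delta>)"
proof -
  have A: "A \<in> carrier_mat n n" and A_square: "A ^\<^sub>m 2 = B"
    using assms(6) unfolding square_root_of_def by simp_all
  interpret nonneg_form_root n H B A
    by unfold_locales (use assms A A_square in simp_all)
  obtain n_as where jnf: "jordan_nf A n_as"
    using char_poly_factorized[OF A] jordan_nf_exists[OF A] by blast
  obtain h where h: "image_mset h (mset_set {1..r}) = nonzero_roots n_as"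
    and h_square: "\<And>j. j \<in> {1..r} \<Longrightarrow> (h j)\<^sup>2 = complex_of_real (ev j)"
    using image_mset_transport[OF _ squares_eq_signed_eigenvalues[OF jnf assms(5)]] by auto
  have "\<forall>j\<in>{1..r}. \<exists>d. d \<in> {1, -1 :: real} \<and>
      (ev j > 0 \<longrightarrow> h j = complex_of_real (d * sqrt (ev j))) \<and>
      (ev j < 0 \<longrightarrow> h j = \<i> * complex_of_real (d * sqrt (- ev j)))"
    using sqrt_sign_choice[OF h_square] by blast
  then obtain \<delta> where \<delta>: "\<forall>j\<in>{1..r}. \<delta> j \<in> {1, -1 :: real} \<and>
      (ev j > 0 \<longrightarrow> h j = complex_of_real (\<delta> j * sqrt (ev j))) \<and>
      (ev j < 0 \<longrightarrow> h j = \<i> * complex_of_real (\<delta> j * sqrt (- ev j)))"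
    by (rule bchoice[THEN exE])
  have "mset (A_minus q r ev \<delta>) + mset (A_plus q ev \<delta>) = image_mset (\<lambda>j. (1, h j)) (mset_set {1..r})"
  proof (rule mset_A_plus_minus)
    note ev = assms(5)[unfolded signed_eigenvalues_def]
    show "q \<le> r" using ev by blast
    show "h j = complex_of_real (\<delta> j * sqrt (ev j))" if "j \<in> {1..q}" for j
    proof -
      have "j \<in> {1..r}" "ev j > 0" using ev that by auto
      with \<delta> show ?thesis by blast
    qed
    show "h j = \<i> * complex_of_real (\<delta> j * sqrt (- ev j))" if "j \<in> {q+1..r}" for j
    proof -
      have "j \<in> {1..r}" "ev j < 0" using ev that by auto
      with \<delta> show ?thesis by blast
    qed
  qed
  also have "\<dots> = image_mset (Pair 1) (nonzero_roots n_as)"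
    unfolding h[symmetric] by (simp add: multiset.map_comp comp_def)
  also have "\<dots> = filter_mset (\<lambda>b. snd b \<noteq> 0) (mset n_as)"
  proof -
    have "\<forall>(k, a)\<in>set n_as. a \<noteq> 0 \<longrightarrow> k = 1"
      using root_block_nonzero[OF jnf] by blast
    then show ?thesis
      unfolding nonzero_roots_def by (induction n_as) auto
  qed
  finally have nonzero: "mset (A_minus q r ev \<delta>) + mset (A_plus q ev \<delta>) =
      filter_mset (\<lambda>b. snd b \<noteq> 0) (mset n_as)" .
  have "mset (A_minus q r ev \<delta> @ A_zero (root_pairing n_as) @ A_plus q ev \<delta>) =
      filter_mset (\<lambda>b. snd b = 0) (mset n_as) + (mset (A_minus q r ev \<delta>) + mset (A_plus q ev \<delta>))"
    by (simp add: mset_A_zero_root_pairing[OF jnf])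
  also have "\<dots> = mset n_as"
    unfolding nonzero by (rule multiset_partition[symmetric])
  finally have blocks: "mset n_as =
      mset (A_minus q r ev \<delta> @ A_zero (root_pairing n_as) @ A_plus q ev \<delta>)" ..
  from jordan_nf_mset_cong[OF jnf blocks] segre_pairing_root_pairing[OF jnf] \<delta>
  show ?thesis by blast
qed

end
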